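(* Let $k(z,w) = \frac{1}{z\overline{w}}\log\big(\frac{1}{1-z\overline{w}}\big)$ for $z,w\in\mathbb{D}$, and let the real numbers $(c_n)_{n=1}^\infty$ be defined by the power series identity $$\sum_{n=1}^\infty c_n (z\overline{w})^n = 1 - \frac{1}{k(z,w)}\qquad (z,w\in\mathbb{D}).$$ Then for every $n\ge 1$, $$c_n = \int_0^1 t\,\frac{\Gamma(n-t)}{\Gamma(n+1)\,\Gamma(1-t)}\, dt \ge 0.$$
   Context: $\mathbb{D}$ is the open unit disc in $\mathbb{C}$; $k$ is the reproducing kernel of the Dirichlet space, with $k(z,w)=1$ when $z\overline w=0$; $\log$ is the principal branch; $\Gamma$ is the Gamma function. *)

theory Defs
  imports "HOL-Analysis.Analysis"
begin

text \<open>Reproducing kernel of the Dirichlet space, relevant for \<open>z\<close>, \<open>w\<close> in the open unit disc,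
  with the removable singularity at \<open>z * cnj w = 0\<close> filled in; \<open>Ln\<close> is the principal branch.\<close>

definition dirichlet_kernel :: "complex \<Rightarrow> complex \<Rightarrow> complex" where
  "dirichlet_kernel z w =
     (if z * cnj w = 0 then 1 else 1 / (z * cnj w) * Ln (1 / (1 - z * cnj w)))"

end

theory Submission
  imports Defs
begin

text \<open>
  Let \<open>x = z * cnj w\<close> be real and nonzero, so that \<open>1 / k = - x / ln (1 - x)\<close>. The key observation is that this is
  an average of powers:
  \<open>- x / ln (1 - x) = integral\<^sub>0\<^sup>1 (1 - x) powr t dt\<close>.
  Hence \<open>1 - 1 / k\<close> is the average over \<open>t \<in> [0, 1]\<close> of \<open>1 - (1 - x) powr t\<close>, which the binomial
  series expands as \<open>\<Sum>n. binomial_weight n t * x ^ Suc n\<close>, where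
  \<open>binomial_weight n t = (-1) ^ n * (t gchoose Suc n)\<close>. For \<open>0 \<le> t \<le> 1\<close> these weights lie
  between 0 and 1, so the series converges uniformly in \<open>t\<close> and may be integrated term by term.
  Comparing coefficients on the real interval \<open>-1 < x < 1\<close> gives
  \<open>c (Suc n) = integral\<^sub>0\<^sup>1 binomial_weight n t dt \<ge> 0\<close>.
  Finally the rising factorial in \<open>binomial_weight\<close> is a quotient of Gamma values wherever
  \<open>1 - t\<close> is not a pole, that is, except at the endpoint \<open>t = 1\<close>, a null set.
\<close>

text \<open>Writing the weight with a rising factorial instead of a generalised binomial coefficient
  makes all factors nonnegative on the unit interval, and matches the Gamma quotient.\<close>

definition binomial_weight :: "nat \<Rightarrow> real \<Rightarrow> real" where
  "binomial_weight n t = t * pochhammer (1 - t) n / fact (Suc n)"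

lemma binomial_weight_eq_gbinomial:
  "binomial_weight n t = (-1) ^ n * (t gchoose Suc n)"
proof -
  have "(-1::real) ^ n * (-1) ^ n = 1"
    by (simp flip: power_mult_distrib)
  thus ?thesis
    by (simp add: binomial_weight_def gbinomial_pochhammer pochhammer_rec
        mult.assoc [symmetric] del: fact_Suc)
qed

lemma binomial_weight_eq_Gamma:
  assumes "t < 1"
  shows "binomial_weight n t =
           t * (Gamma (real (Suc n) - t) / (Gamma (real (Suc n) + 1) * Gamma (1 - t)))"
proof -
  have "1 - t \<notin> \<int>\<^sub>\<le>\<^sub>0"
    using assms by (auto elim!: nonpos_Ints_cases)
  hence "pochhammer (1 - t) n = Gamma (1 - t + real n) / Gamma (1 - t)"
    by (rule pochhammer_Gamma)
  moreover have "Gamma (real (Suc n) + 1) = fact (Suc n)"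
    using Gamma_fact [of "Suc n", where 'a = real] by (simp only: add.commute)
  ultimately show ?thesis
    by (simp add: binomial_weight_def algebra_simps del: fact_Suc)
qed

lemma pochhammer_one_minus_bounds:
  fixes t :: real
  assumes "0 \<le> t" "t \<le> 1"
  shows "0 \<le> pochhammer (1 - t) n \<and> pochhammer (1 - t) n \<le> fact n"
proof (induction n)
  case (Suc n)
  have "pochhammer (1 - t) n * (1 - t + real n) \<le> fact n * (1 + real n)"
    using Suc assms by (intro mult_mono) auto
  thus ?case
    using Suc assms by (simp add: pochhammer_rec' mult.commute)
qed simp

lemma binomial_weight_bounds:
  assumes "0 \<le> t" "t \<le> 1"
  shows "0 \<le> binomial_weight n t" "binomial_weight n t \<le> 1"
proof -
  note p = pochhammer_one_minus_bounds [OF assms, of n]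
  show "0 \<le> binomial_weight n t"
    using p assms by (simp add: binomial_weight_def)
  have "t * pochhammer (1 - t) n \<le> 1 * fact n"
    using p assms by (intro mult_mono) auto
  also have "\<dots> \<le> fact (Suc n)"
    by (simp add: fact_mono del: fact_Suc)
  finally show "binomial_weight n t \<le> 1"
    by (simp add: binomial_weight_def del: fact_Suc)
qed

lemma continuous_on_binomial_weight: "continuous_on A (binomial_weight n)"
  unfolding binomial_weight_def pochhammer_prod by (intro continuous_intros) auto

lemma binomial_weight_sums:
  assumes "\<bar>x\<bar> < 1"
  shows "(\<lambda>n. binomial_weight n t * x ^ Suc n) sums (1 - (1 - x) powr t)"
proof -
  have "(\<lambda>n. (t gchoose n) * (-x) ^ n) sums (1 + -x) powr t"
    using assms by (intro gen_binomial_real) auto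
  hence "(\<lambda>n. (t gchoose Suc n) * (-x) ^ Suc n) sums ((1 - x) powr t - 1)"
    using sums_Suc_iff [of "\<lambda>n. (t gchoose n) * (-x) ^ n" "(1 - x) powr t - 1"] by simp
  hence "(\<lambda>n. - ((t gchoose Suc n) * (-x) ^ Suc n)) sums - ((1 - x) powr t - 1)"
    by (rule sums_minus)
  moreover have "- ((t gchoose Suc n) * (-x) ^ Suc n) = binomial_weight n t * x ^ Suc n" for n
    unfolding binomial_weight_eq_gbinomial power_minus [of x] by simp
  ultimately show ?thesis by (simp only: minus_diff_eq)
qed

lemma has_integral_powr_exponent:
  fixes a :: real
  assumes "0 < a" "a \<noteq> 1"
  shows "((\<lambda>t. a powr t) has_integral (a - 1) / ln a) {0..1}"
proof -
  have "((\<lambda>t. a powr t) has_integral (a powr 1 / ln a - a powr 0 / ln a)) {0..1}"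
  proof (rule fundamental_theorem_of_calculus)
    show "((\<lambda>t. a powr t / ln a) has_vector_derivative a powr t) (at t within {0..1})" for t
      using assms unfolding has_real_derivative_iff_has_vector_derivative [symmetric] powr_def
      by (auto intro!: derivative_eq_intros)
  qed simp
  thus ?thesis
    using assms by (simp add: diff_divide_distrib)
qed

text \<open>Termwise integration is justified by the Weierstrass test: the weights are at most 1, so
  the geometric series dominates uniformly in \<open>t\<close>.\<close>

lemma integral_binomial_weight_sums:
  assumes "\<bar>x\<bar> < 1" "x \<noteq> 0"
  shows "(\<lambda>n. integral {0..1} (binomial_weight n) * x ^ Suc n) sums (1 + x / ln (1 - x))"
proof -
  define S where "S = (\<lambda>N t. \<Sum>n<N. binomial_weight n t * x ^ Suc n)"
  have "uniform_limit {0..1} S (\<lambda>t. \<Sum>n. binomial_weight n t * x ^ Suc n) sequentially"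
    unfolding S_def
  proof (rule Weierstrass_m_test)
    fix n and t :: real assume "t \<in> {0..1}"
    hence "\<bar>binomial_weight n t\<bar> * \<bar>x\<bar> ^ Suc n \<le> 1 * \<bar>x\<bar> ^ Suc n"
      using binomial_weight_bounds [of t n] by (intro mult_right_mono) auto
    thus "norm (binomial_weight n t * x ^ Suc n) \<le> \<bar>x\<bar> ^ Suc n"
      by (simp add: abs_mult power_abs)
  next
    show "summable (\<lambda>n. \<bar>x\<bar> ^ Suc n)"
      using assms by (subst summable_Suc_iff) simp
  qed
  moreover have "(\<Sum>n. binomial_weight n t * x ^ Suc n) = 1 - (1 - x) powr t" for t
    using binomial_weight_sums [OF assms(1)] by (simp add: sums_iff)
  ultimately have "uniform_limit {0..1} S (\<lambda>t. 1 - (1 - x) powr t) sequentially"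
    by simp
  moreover have "continuous_on {0..1} (S N)" for N
    unfolding S_def by (intro continuous_intros continuous_on_binomial_weight)
  ultimately obtain I J where
      I: "\<And>N. (S N has_integral I N) {0..1}" and
      J: "((\<lambda>t. 1 - (1 - x) powr t) has_integral J) {0..1}" and
      lim: "I \<longlonglongrightarrow> J"
    by (rule uniform_limit_integral) auto
  have "((\<lambda>t. 1 - (1 - x) powr t) has_integral 1 - ((1 - x) - 1) / ln (1 - x)) {0..1}"
    using assms has_integral_const_real [of "1::real" 0 1]
    by (intro has_integral_diff has_integral_powr_exponent) auto
  hence "J = 1 + x / ln (1 - x)"
    using has_integral_unique [OF J] by simp
  moreover have "(S N has_integral (\<Sum>n<N. integral {0..1} (binomial_weight n) * x ^ Suc n)) {0..1}"
    for N
    unfolding S_def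
    by (intro has_integral_sum has_integral_mult_left integrable_integral
        integrable_continuous_interval continuous_on_binomial_weight) auto
  hence "I = (\<lambda>N. \<Sum>n<N. integral {0..1} (binomial_weight n) * x ^ Suc n)"
    using has_integral_unique [OF I] by blast
  ultimately show ?thesis
    using lim by (simp add: sums_def)
qed

text \<open>If all coefficients below \<open>n\<close> vanish, dividing by \<open>x ^ n\<close> leaves a power series that
  vanishes for \<open>x \<noteq> 0\<close>; its limit at 0 is the \<open>n\<close>-th coefficient.\<close>

lemma powser_sums_zero_imp_coeff_zero:
  fixes a :: "nat \<Rightarrow> 'a :: {real_normed_field, banach}"
  assumes "0 < s" and sums: "\<And>x. x \<noteq> 0 \<Longrightarrow> norm x < s \<Longrightarrow> (\<lambda>n. a n * x ^ n) sums 0"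
  shows "a n = 0"
proof (induction n rule: less_induct)
  case (less n)
  have "(\<lambda>k. a (k + n) * x ^ k) sums 0" if "x \<noteq> 0" "norm x < s" for x
  proof -
    have "(\<lambda>k. a (k + n) * x ^ (k + n)) sums 0"
      using sums [OF that] less by (subst sums_iff_shift) simp
    from sums_mult [OF this, of "inverse (x ^ n)"] show ?thesis
      using that by (simp add: power_add field_simps)
  qed
  hence "((\<lambda>_. 0) \<longlongrightarrow> a (0 + n)) (at (0 :: 'a))"
    using \<open>0 < s\<close> by (intro powser_limit_0_strong [of s "\<lambda>k. a (k + n)"]) auto
  thus ?case
    by (simp add: tendsto_const_iff)
qed

lemma dirichlet_kernel_of_real:
  assumes "a * b < 1" "a * b \<noteq> 0"
  shows "dirichlet_kernel (of_real a) (of_real b) = of_real (- ln (1 - a * b) / (a * b))"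
proof -
  have "1 / (1 - of_real (a * b)) = (of_real (1 / (1 - a * b)) :: complex)"
    by simp
  hence "Ln (1 / (1 - of_real (a * b))) = of_real (ln (1 / (1 - a * b)))"
    using assms by (simp only: Ln_of_real zero_less_divide_1_iff diff_gt_0_iff_gt)
  also have "ln (1 / (1 - a * b)) = - ln (1 - a * b)"
    using assms by (simp add: ln_div)
  finally show ?thesis
    using assms by (simp add: dirichlet_kernel_def)
qed

theorem proposition1p2:
  fixes c :: "nat \<Rightarrow> real"
  assumes "\<And>z w :: complex. z \<in> ball 0 1 \<Longrightarrow> w \<in> ball 0 1 \<Longrightarrow>
             (\<lambda>n. of_real (c (Suc n)) * (z * cnj w) ^ Suc n) sums (1 - 1 / dirichlet_kernel z w)"
  shows "\<forall>n\<ge>1.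
           ((\<lambda>t::real. t * (Gamma (real n - t) / (Gamma (real n + 1) * Gamma (1 - t))))
              has_integral c n) {0..1} \<and>
           0 \<le> c n"
proof -
  have series: "(\<lambda>n. c (Suc n) * x ^ Suc n) sums (1 + x / ln (1 - x))"
    if x: "x \<noteq> 0" "\<bar>x\<bar> < 1" for x :: real
  proof -
    \<comment> \<open>Both factors must lie in the disc, and \<open>x\<close> may be negative, so \<open>b\<close> carries the sign.\<close>
    define a b where "a = sqrt \<bar>x\<bar>" and "b = sgn x * sqrt \<bar>x\<bar>"
    have ab: "a * b = x"
      by (simp add: a_def b_def sgn_if)
    have "complex_of_real a \<in> ball 0 1" "complex_of_real b \<in> ball 0 1"
      using x by (auto simp: a_def b_def abs_mult sgn_if)
    from assms [OF this]
    have "(\<lambda>n. of_real (c (Suc n)) * (of_real (a * b)) ^ Suc n) sums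
            (1 - 1 / dirichlet_kernel (of_real a) (of_real b))"
      by simp
    also have "dirichlet_kernel (of_real a) (of_real b) = of_real (- ln (1 - x) / x)"
      using dirichlet_kernel_of_real [of a b] x by (simp add: ab)
    finally have "(\<lambda>n. complex_of_real (c (Suc n) * x ^ Suc n)) sums
                    of_real (1 + x / ln (1 - x))"
      by (simp add: ab)
    thus ?thesis
      by (simp only: sums_of_real_iff)
  qed
  define d where "d = (\<lambda>n. c (Suc n) - integral {0..1} (binomial_weight n))"
  have "(\<lambda>n. d n * x ^ n) sums 0" if x: "x \<noteq> 0" "norm x < 1" for x
  proof -
    have "(\<lambda>n. d n * x ^ Suc n) sums 0"
      using sums_diff [OF series integral_binomial_weight_sums, of x x] x
      by (simp add: d_def left_diff_distrib)
    from sums_mult [OF this, of "inverse x"] show ?thesis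
      using x by (simp add: field_simps)
  qed
  hence "d n = 0" for n
    using powser_sums_zero_imp_coeff_zero [of 1 d n] by simp
  hence c_eq: "c (Suc n) = integral {0..1} (binomial_weight n)" for n
    by (simp add: d_def)
  show ?thesis
  proof (intro allI impI)
    fix n :: nat assume "n \<ge> 1"
    then obtain m where n: "n = Suc m"
      by (cases n) auto
    have int: "(binomial_weight m has_integral c n) {0..1}"
      unfolding n c_eq
      by (intro integrable_integral integrable_continuous_interval continuous_on_binomial_weight)
    have "((\<lambda>t. t * (Gamma (real n - t) / (Gamma (real n + 1) * Gamma (1 - t))))
             has_integral c n) {0..1}"
      by (rule has_integral_spike_finite [OF _ _ int, of "{1}"])
         (auto simp: n binomial_weight_eq_Gamma simp del: of_nat_Suc)
    moreover have "0 \<le> c n"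
      by (rule has_integral_nonneg [OF int]) (use binomial_weight_bounds in auto)
    ultimately show "((\<lambda>t. t * (Gamma (real n - t) / (Gamma (real n + 1) * Gamma (1 - t))))
             has_integral c n) {0..1} \<and> 0 \<le> c n" ..
  qed
qed

end
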